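(* Let $$\Lambda:=\left\{\sum_{k=0}^N4^k\left(4^{10^{k+2}-k}+1\right)\delta_k : \delta_k\in\{0,1\},\ N\ge0\right\}.$$ There exists a spectral labeling $\mathcal L$ of the infinite binary tree such that $\Lambda(\mathcal L)=\Lambda$, so the set $\{e_\lambda:\lambda\in\Lambda\}$ forms a maximal family of orthogonal exponentials in $L^2(\mu_4)$. Nonetheless $\Lambda$ is not a spectrum for $\mu_4$.
   Context: Measure. $\mu_4$ is the unique Borel probability measure on $\mathbb{R}$ satisfying $\int f(x)\,d\mu_4(x)=\frac12\left(\int f(\tfrac{x}{4})\,d\mu_4(x)+\int f(\tfrac{x+2}{4})\,d\mu_4(x)\right)$ for all $f\in C_c(\mathbb{R})$. For $\lambda\in\mathbb{R}$, $e_\lambda(x):=e^{2\pi i\lambda x}$. A set $\Lambda\subset\mathbb{R}$ is a spectrum for $\mu_4$ if $\{e_\lambda:\lambda\in\Lambda\}$ is an orthonormal basis of $L^2(\mu_4)$. A set $\{e_\lambda:\lambda\in\Lambda\}$ of mutually orthogonal exponentials in $L^2(\mu_4)$ is maximal if no $e_{\lambda'}$ with $\lambda'\in\mathbb{R}\setminus\Lambda$ is orthogonal to all $e_\lambda$, $\lambda\in\Lambda$. Base 4 expansion. For $k\in\mathbb{Z}$ put $k_0=k$ and inductively $k_n=d_n+4k_{n+1}$ with $d_n\in\{0,1,2,3\}$, $k_{n+1}\in\mathbb{Z}$. The infinite string $d_0d_1d_2\dots$ is the base 4 expansion of $k$, written $k=d_0d_1\dots$. It ends in $\underline 0=000\dots$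 if $k\ge0$ and in $\underline 3=333\dots$ if $k<0$. Conversely every infinite string over $\{0,1,2,3\}$ ending in $\underline 0$ or $\underline 3$ is the expansion of exactly one integer: $d_0\dots d_N\underline 0=\sum_{n=0}^N4^nd_n$ and $d_0\dots d_N\underline 3=\sum_{n=0}^N4^nd_n-4^{N+1}$. Spectral labeling. Let $\mathcal T$ be the complete infinite rooted binary tree (root $\emptyset$, each vertex having two outgoing edges to its two children). A spectral labeling $\mathcal L$ is a labeling of the edges of $\mathcal T$ with labels in $\{0,1,2,3\}$ such that: (i) for each vertex $v$, the two edges starting from $v$ have labels of different parity; (ii) for each vertex $v$ there exists an infinite (downward) path starting from $v$ whose edges are eventually all labeled $0$ or eventually all labeled $3$. An infinite path is identified with the infinite word of labels read along it. Put $$\Lambda(\mathcal L):=\{k=d_0d_1\dots\in\mathbb{Z} : d_0d_1\dots\text{ is an infinite path in the tree starting from }\emptyset\text{ and ending in }\underline 0\text{ or }\underline 3\}.$$ *)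

theory Defs
  imports "HOL-Probability.Probability"
begin

section \<open>The measure\<close>

definition compactly_supported_continuous :: "(real \<Rightarrow> complex) set" where
  "compactly_supported_continuous =
     {f. continuous_on UNIV f \<and> compact (closure {x. f x \<noteq> 0})}"

definition is_mu4 :: "real measure \<Rightarrow> bool" where
  "is_mu4 M \<longleftrightarrow> prob_space M \<and> sets M = sets borel \<and>
     (\<forall>f\<in>compactly_supported_continuous.
        (LINT x|M. f x) =
          1 / 2 * ((LINT x|M. f (x / 4)) + (LINT x|M. f ((x + 2) / 4))))"

definition mu4 :: "real measure" where
  "mu4 = (THE M. is_mu4 M)"

section \<open>Exponentials in the space of square-integrable functions\<close>

text \<open>Elements of the Hilbert space are given by square-integrable representatives; all notions
  below are invariant under changes on null sets.\<close>

definition square_integrable :: "'a measure \<Rightarrow> ('a \<Rightarrow> complex) \<Rightarrow> bool" where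
  "square_integrable M f \<longleftrightarrow>
     f \<in> borel_measurable M \<and> integrable M (\<lambda>x. (cmod (f x))\<^sup>2)"

definition l2_inner :: "'a measure \<Rightarrow> ('a \<Rightarrow> complex) \<Rightarrow> ('a \<Rightarrow> complex) \<Rightarrow> complex" where
  "l2_inner M f g = (LINT x|M. f x * cnj (g x))"

definition l2_norm :: "'a measure \<Rightarrow> ('a \<Rightarrow> complex) \<Rightarrow> real" where
  "l2_norm M f = sqrt (LINT x|M. (cmod (f x))\<^sup>2)"

definition orthonormal_L2 :: "'a measure \<Rightarrow> ('a \<Rightarrow> complex) set \<Rightarrow> bool" where
  "orthonormal_L2 M B \<longleftrightarrow>
     (\<forall>b\<in>B. square_integrable M b \<and> l2_norm M b = 1) \<and>
     pairwise (\<lambda>b b'. l2_inner M b b' = 0) B"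

text \<open>An orthonormal basis in the Hilbert space sense: the finite complex linear combinations
  are dense.\<close>

definition orthonormal_basis_L2 :: "'a measure \<Rightarrow> ('a \<Rightarrow> complex) set \<Rightarrow> bool" where
  "orthonormal_basis_L2 M B \<longleftrightarrow> orthonormal_L2 M B \<and>
     (\<forall>f. square_integrable M f \<longrightarrow>
        (\<forall>\<epsilon>>0. \<exists>F c. finite F \<and> F \<subseteq> B \<and> l2_norm M (\<lambda>x. f x - (\<Sum>b\<in>F. c b * b x)) < \<epsilon>))"

definition expo :: "real \<Rightarrow> real \<Rightarrow> complex" where
  "expo l x = exp (2 * of_real pi * \<i> * of_real l * of_real x)"

definition is_spectrum :: "real measure \<Rightarrow> real set \<Rightarrow> bool" where
  "is_spectrum M S \<longleftrightarrow> orthonormal_basis_L2 M (expo ` S)"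

definition orthogonal_exponentials :: "real measure \<Rightarrow> real set \<Rightarrow> bool" where
  "orthogonal_exponentials M S \<longleftrightarrow>
     pairwise (\<lambda>l l'. l2_inner M (expo l) (expo l') = 0) S"

definition maximal_orthogonal_exponentials :: "real measure \<Rightarrow> real set \<Rightarrow> bool" where
  "maximal_orthogonal_exponentials M S \<longleftrightarrow> orthogonal_exponentials M S \<and>
     \<not> (\<exists>l'. l' \<notin> S \<and> (\<forall>l\<in>S. l2_inner M (expo l') (expo l) = 0))"

section \<open>Base 4 expansions of integers\<close>

text \<open>Since \<open>div\<close> on integers rounds towards minus infinity and \<open>mod 4\<close> takes
  values in \<open>{0,1,2,3}\<close>, this is the unique choice with
  \<open>base4_quot k n = base4_digit k n + 4 * base4_quot k (Suc n)\<close>, also for negative \<open>k\<close>.\<close>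

primrec base4_quot :: "int \<Rightarrow> nat \<Rightarrow> int" where
  "base4_quot k 0 = k"
| "base4_quot k (Suc n) = base4_quot k n div 4"

definition base4_digit :: "int \<Rightarrow> nat \<Rightarrow> int" where
  "base4_digit k n = base4_quot k n mod 4"

definition ends_in :: "(nat \<Rightarrow> int) \<Rightarrow> int \<Rightarrow> bool" where
  "ends_in w d \<longleftrightarrow> (\<exists>N. \<forall>n\<ge>N. w n = d)"

section \<open>Spectral labelings of the infinite binary tree\<close>

text \<open>A vertex is the finite list of left/right choices leading to it from the root \<open>[]\<close>;
  the children of \<open>v\<close> are \<open>v @ [False]\<close> and \<open>v @ [True]\<close>, and
  \<open>L v b\<close> is the label of the edge from \<open>v\<close> to \<open>v @ [b]\<close>.\<close>

type_synonym edge_labeling = "bool list \<Rightarrow> bool \<Rightarrow> int"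

text \<open>An infinite path starting from \<open>v\<close> is given by its sequence \<open>p\<close> of choices.\<close>

definition path_word :: "edge_labeling \<Rightarrow> bool list \<Rightarrow> (nat \<Rightarrow> bool) \<Rightarrow> nat \<Rightarrow> int" where
  "path_word L v p n = L (v @ map p [0..<n]) (p n)"

definition spectral_labeling :: "edge_labeling \<Rightarrow> bool" where
  "spectral_labeling L \<longleftrightarrow>
     (\<forall>v b. L v b \<in> {0, 1, 2, 3}) \<and>
     (\<forall>v. even (L v False) \<noteq> even (L v True)) \<and>
     (\<forall>v. \<exists>p. ends_in (path_word L v p) 0 \<or> ends_in (path_word L v p) 3)"

definition labeling_set :: "edge_labeling \<Rightarrow> int set" where
  "labeling_set L =
     {k. \<exists>p. path_word L [] p = base4_digit k \<and>
             (ends_in (path_word L [] p) 0 \<or> ends_in (path_word L [] p) 3)}"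

section \<open>The set under consideration\<close>

definition Lam :: "int set" where
  "Lam = {\<Sum>k\<le>N. 4 ^ k * (4 ^ (10 ^ (k + 2) - k) + 1) * \<delta> k | (N :: nat) (\<delta> :: nat \<Rightarrow> int).
            \<forall>k. \<delta> k \<in> {0, 1}}"

end

theory Submission
  imports Defs
begin

text \<open>The Fourier transform of \<open>mu4\<close> satisfies \<open>fourier l = fourier (l / 4) * (1 + cis (pi * l)) / 2\<close>,
  where the second factor has modulus \<open>\<bar>cos (pi * l / 2)\<bar>\<close>. Hence it is determined by its continuity
  at \<open>0\<close>, which makes \<open>mu4\<close> unique, and its zeros are the numbers \<open>4 ^ j * q\<close> with \<open>q\<close> odd.
  Two distinct paths of a spectral labeling separate at a vertex with labels of different parity, so
  the difference of the two integers is such a zero, while following parities shows that no further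
  frequency is orthogonal to all of them.

  For the set at hand, the last nonzero digit of a nonzero element comes after such a long block of
  zeros that a single cosine factor makes \<open>fourier (1 - l)\<close> tiny. Since \<open>fourier 1 = 0\<close>, the sum of
  \<open>\<bar>fourier (1 - l)\<bar>\<^sup>2\<close> over the set is at most \<open>1 / 2\<close>, so Parseval's identity fails for the
  exponential of frequency \<open>1\<close>.\<close>

section \<open>The Fourier transform and uniqueness of the measure\<close>

definition fourier :: "real measure \<Rightarrow> real \<Rightarrow> complex" where
  "fourier M l = (LINT x|M. expo l x)"

lemma expo_eq_cis: "expo l x = cis (2 * pi * l * x)"
  by (simp add: expo_def cis_conv_exp mult_ac)

lemma norm_expo [simp]: "cmod (expo l x) = 1"
  by (simp add: expo_eq_cis)

lemma expo_measurable [measurable]: "expo l \<in> borel_measurable borel"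
  unfolding expo_def by measurable

lemma continuous_on_expo: "continuous_on UNIV (expo l)"
  unfolding expo_def by (intro continuous_intros)

lemma expo_mult_cnj: "expo l x * cnj (expo l' x) = expo (l - l') x"
  by (simp add: expo_eq_cis cis_cnj cis_mult algebra_simps)

text \<open>For \<open>a\<close> distinct from \<open>b\<close>, \<open>expo (a - b)\<close> equals
  -1 at half its period. Injectivity lets sums over sets of exponentials be reindexed by
  frequencies.\<close>

lemma inj_expo: "inj expo"
proof (rule injI)
  fix a b assume eq: "expo a = expo b"
  show "a = b"
  proof (rule ccontr)
    assume "a \<noteq> b"
    have "expo (a - b) x = 1" for x
      using expo_mult_cnj[of a x b] expo_mult_cnj[of b x b] eq by (simp add: expo_def)
    moreover have "expo (a - b) (1 / (2 * (a - b))) = cis pi"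
      unfolding expo_eq_cis using \<open>a \<noteq> b\<close> by (intro arg_cong[where f = cis]) (simp add: field_simps)
    ultimately show False by simp
  qed
qed

lemma is_mu4_real_distribution: "is_mu4 M \<Longrightarrow> real_distribution M"
  by (simp add: is_mu4_def real_distribution_def real_distribution_axioms_def)

text \<open>Exponentials lack compact support, so the defining identity is extended to them: apply
  it to cutoffs \<open>g n\<close>, which agree with \<open>f\<close> on \<open>[-n, n]\<close> and
  vanish outside \<open>[-n-1, n+1]\<close>, and pass to the limit by dominated convergence.\<close>

lemma is_mu4_bounded_continuous:
  fixes f :: "real \<Rightarrow> complex"
  assumes M: "is_mu4 M" and cont: "continuous_on UNIV f" and bnd: "\<And>x. cmod (f x) \<le> B"
  shows "(LINT x|M. f x) = 1 / 2 * ((LINT x|M. f (x / 4)) + (LINT x|M. f ((x + 2) / 4)))"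
proof -
  interpret real_distribution M using M by (rule is_mu4_real_distribution)
  define g :: "nat \<Rightarrow> real \<Rightarrow> complex"
    where "g n x = f x * of_real (max 0 (min 1 (real n + 1 - \<bar>x\<bar>)))" for n x
  have g_cont: "continuous_on UNIV (g n)" for n
    unfolding g_def by (intro continuous_intros cont)
  have g_le: "cmod (g n x) \<le> B" for n x
  proof -
    have "cmod (g n x) \<le> cmod (f x) * 1"
      unfolding g_def norm_mult by (intro mult_left_mono) auto
    then show ?thesis using bnd[of x] by simp
  qed
  have lim: "(\<lambda>n. LINT x|M. g n (h x)) \<longlonglongrightarrow> (LINT x|M. f (h x))"
    if h: "h \<in> borel_measurable borel" for h
  proof (rule integral_dominated_convergence[where w = "\<lambda>_. B"])
    have [measurable]: "h \<in> borel_measurable borel" "f \<in> borel_measurable borel"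
        "\<And>n. g n \<in> borel_measurable borel"
      using h cont g_cont by (auto intro: borel_measurable_continuous_onI)
    show "(\<lambda>x. f (h x)) \<in> borel_measurable M" "\<And>n. (\<lambda>x. g n (h x)) \<in> borel_measurable M"
      by measurable
    show "AE x in M. (\<lambda>n. g n (h x)) \<longlonglongrightarrow> f (h x)"
    proof (rule AE_I2)
      fix x
      have "eventually (\<lambda>n. g n (h x) = f (h x)) sequentially"
      proof (rule eventually_sequentiallyI)
        fix n assume "nat \<lceil>\<bar>h x\<bar>\<rceil> \<le> n"
        then have "\<bar>h x\<bar> \<le> real n" by linarith
        then show "g n (h x) = f (h x)" by (simp add: g_def)
      qed
      then show "(\<lambda>n. g n (h x)) \<longlonglongrightarrow> f (h x)"
        by (rule tendsto_eventually)
    qed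
  qed (use g_le in auto)
  have "g n \<in> compactly_supported_continuous" for n
  proof -
    have "{x. g n x \<noteq> 0} \<subseteq> cball 0 (real n + 1)"
      by (auto simp: g_def dist_real_def)
    then have "bounded {x. g n x \<noteq> 0}"
      using bounded_cball bounded_subset by blast
    then have "compact (closure {x. g n x \<noteq> 0})"
      by simp
    then show ?thesis
      using g_cont by (simp add: compactly_supported_continuous_def)
  qed
  then have "(LINT x|M. g n x) =
      1 / 2 * ((LINT x|M. g n (x / 4)) + (LINT x|M. g n ((x + 2) / 4)))" for n
    using M by (simp add: is_mu4_def)
  moreover have "(\<lambda>n. 1 / 2 * ((LINT x|M. g n (x / 4)) + (LINT x|M. g n ((x + 2) / 4))))
      \<longlonglongrightarrow> 1 / 2 * ((LINT x|M. f (x / 4)) + (LINT x|M. f ((x + 2) / 4)))"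
    by (intro tendsto_intros lim) measurable
  moreover have "(\<lambda>n. LINT x|M. g n x) \<longlonglongrightarrow> (LINT x|M. f x)"
    by (rule lim) measurable
  ultimately show ?thesis
    by (simp only: LIMSEQ_unique)
qed

lemma fourier_rec:
  assumes "is_mu4 M"
  shows "fourier M l = fourier M (l / 4) * ((1 + cis (pi * l)) / 2)"
proof -
  have "expo l (x / 4) = expo (l / 4) x" for x
    by (simp add: expo_eq_cis mult.assoc)
  moreover have "expo l ((x + 2) / 4) = expo (l / 4) x * cis (pi * l)" for x
    unfolding expo_eq_cis cis_mult by (intro arg_cong[where f = cis]) (simp add: field_simps)
  ultimately show ?thesis
    using is_mu4_bounded_continuous[OF assms continuous_on_expo, of l 1]
    by (simp add: fourier_def algebra_simps)
qed

lemma norm_half_one_plus_cis: "cmod ((1 + cis (2 * t)) / 2) = \<bar>cos t\<bar>"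
proof -
  have "1 + cis (2 * t) = 2 * cos t * cis t"
    by (simp add: complex_eq_iff cos_double_cos sin_double power2_eq_square)
  then have "(1 + cis (2 * t)) / 2 = cos t * cis t"
    by simp
  then show ?thesis
    by (simp add: norm_mult)
qed

lemma norm_fourier_rec:
  assumes "is_mu4 M"
  shows "cmod (fourier M l) = \<bar>cos (pi * l / 2)\<bar> * cmod (fourier M (l / 4))"
  using norm_half_one_plus_cis[of "pi * l / 2"]
  by (subst fourier_rec[OF assms]) (simp add: norm_mult)

lemma norm_fourier_le_1:
  assumes "is_mu4 M"
  shows "cmod (fourier M l) \<le> 1"
proof -
  interpret real_distribution M using assms by (rule is_mu4_real_distribution)
  have "cmod (fourier M l) \<le> (LINT x|M. cmod (expo l x))"
    unfolding fourier_def by (rule integral_norm_bound)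
  then show ?thesis using prob_space by simp
qed

text \<open>Iterating the recursion yields a product of cosines. All factors have modulus at most 1,
  so any single one bounds the transform; here it is the one belonging to
  \<open>l / 4 ^ n\<close>.\<close>

lemma norm_fourier_le_cos:
  assumes "is_mu4 M"
  shows "cmod (fourier M l) \<le> \<bar>cos (2 * pi * l / 4 ^ Suc n)\<bar>"
proof (induction n arbitrary: l)
  case 0
  then show ?case
    using norm_fourier_rec[OF assms, of l] norm_fourier_le_1[OF assms, of "l / 4"]
    by (simp add: mult_left_le)
next
  case (Suc n)
  have "cmod (fourier M l) \<le> cmod (fourier M (l / 4))"
    using norm_fourier_rec[OF assms, of l] by (simp add: mult_left_le_one_le)
  also have "\<dots> \<le> \<bar>cos (2 * pi * (l / 4) / 4 ^ Suc n)\<bar>"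
    by (rule Suc)
  finally show ?case by simp
qed

lemma fourier_0:
  assumes "is_mu4 M"
  shows "fourier M 0 = 1"
proof -
  interpret real_distribution M using assms by (rule is_mu4_real_distribution)
  show ?thesis using prob_space by (simp add: fourier_def expo_def)
qed

lemma fourier_contraction_limit:
  assumes "is_mu4 M"
  shows "(\<lambda>n. fourier M (l / 4 ^ n)) \<longlonglongrightarrow> 1"
proof -
  interpret real_distribution M using assms by (rule is_mu4_real_distribution)
  have l: "(\<lambda>n. l / 4 ^ n) \<longlonglongrightarrow> 0"
    by (rule LIMSEQ_divide_realpow_zero) simp
  have "(\<lambda>n. LINT x|M. expo (l / 4 ^ n) x) \<longlonglongrightarrow> (LINT x|M. expo 0 x)"
  proof (rule integral_dominated_convergence[where w = "\<lambda>_. 1"])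
    show "AE x in M. (\<lambda>n. expo (l / 4 ^ n) x) \<longlonglongrightarrow> expo 0 x"
      unfolding expo_def by (intro AE_I2 tendsto_intros l)
  qed auto
  then show ?thesis
    using fourier_0[OF assms] by (simp add: fourier_def)
qed

text \<open>The difference of the two transforms obeys the same recursion, so its modulus can only
  grow when \<open>l\<close> is replaced by \<open>l / 4\<close>; yet it tends to 0 along
  \<open>l / 4 ^ n\<close>. Levy's theorem then identifies the measures.\<close>

lemma is_mu4_unique:
  assumes M: "is_mu4 M" and N: "is_mu4 N"
  shows "M = N"
proof -
  have "fourier M l = fourier N l" for l
  proof -
    let ?d = "\<lambda>l. cmod (fourier M l - fourier N l)"
    have step: "?d l \<le> ?d (l / 4)" for l
    proof -
      have "fourier M l - fourier N l =
          (fourier M (l / 4) - fourier N (l / 4)) * ((1 + cis (2 * (pi * l / 2))) / 2)"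
        using fourier_rec[OF M, of l] fourier_rec[OF N, of l] by (simp add: algebra_simps)
      then have "?d l = ?d (l / 4) * \<bar>cos (pi * l / 2)\<bar>"
        by (simp only: norm_mult norm_half_one_plus_cis)
      then show ?thesis by (simp add: mult_left_le)
    qed
    have "?d l \<le> ?d (l / 4 ^ n)" for n
    proof (induction n)
      case (Suc n)
      then show ?case using step[of "l / 4 ^ n"] by (simp add: mult.commute)
    qed simp
    moreover have "(\<lambda>n. ?d (l / 4 ^ n)) \<longlonglongrightarrow> cmod (1 - 1)"
      by (intro tendsto_intros fourier_contraction_limit M N)
    ultimately have "?d l \<le> cmod (1 - 1)"
      by (intro LIMSEQ_le_const[of _ "cmod (1 - 1)"]) auto
    then show ?thesis by simp
  qed
  moreover have "char M t = fourier M (t / (2 * pi))" for M t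
    by (simp add: char_def fourier_def expo_eq_cis cis_conv_exp)
  ultimately have "char M = char N" by auto
  then show ?thesis
    using Levy_uniqueness is_mu4_real_distribution M N by blast
qed

section \<open>Existence of the measure\<close>

definition coin_stream :: "bool stream measure" where
  "coin_stream = stream_space (measure_pmf (bernoulli_pmf (1 / 2)))"

text \<open>A random point of the Cantor set of numbers with base 4 digits 0 and 2; its law under
  fair coin tosses will be \<open>mu4\<close>.\<close>

definition cantor_point :: "bool stream \<Rightarrow> real" where
  "cantor_point s = (\<Sum>n. 2 * of_bool (s !! n) / 4 ^ Suc n)"

lemma cantor_point_measurable [measurable]: "cantor_point \<in> borel_measurable coin_stream"
proof -
  have "(\<lambda>s. s !! n) \<in> measurable coin_stream (count_space UNIV)" for n
    using measurable_snth[of n "measure_pmf (bernoulli_pmf (1 / 2))"]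
    by (simp add: coin_stream_def)
  then have [measurable]: "(\<lambda>s. of_bool (s !! n) :: real) \<in> borel_measurable coin_stream" for n
    by measurable
  show ?thesis unfolding cantor_point_def by measurable
qed

lemma cantor_point_Stream: "cantor_point (b ## s) = (2 * of_bool b + cantor_point s) / 4"
proof -
  have summ: "summable (\<lambda>n. 2 * of_bool (t !! n) / 4 ^ Suc n :: real)" for t :: "bool stream"
  proof (rule summable_comparison_test)
    show "summable (\<lambda>n. (1 / 4) ^ n :: real)" by (intro summable_geometric) simp
    show "\<exists>N. \<forall>n\<ge>N. norm (2 * of_bool (t !! n) / 4 ^ Suc n :: real) \<le> (1 / 4) ^ n"
      by (intro exI[of _ 0]) (auto simp: power_divide field_simps)
  qed
  have "cantor_point (b ## s) =
      (\<Sum>n. 2 * of_bool ((b ## s) !! Suc n) / 4 ^ Suc (Suc n)) + 2 * of_bool b / 4"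
    unfolding cantor_point_def using suminf_split_head[OF summ[of "b ## s"]] by simp
  also have "(\<Sum>n. 2 * of_bool ((b ## s) !! Suc n) / 4 ^ Suc (Suc n) :: real) = cantor_point s / 4"
    unfolding cantor_point_def using suminf_divide[OF summ[of s], of 4] by (simp add: mult.commute)
  finally show ?thesis by (simp add: field_simps)
qed

text \<open>An independent first sample put before a random stream does not change the law of the
  stream. This is the source of the self-similarity of \<open>mu4\<close>.\<close>

lemma (in prob_space) stream_space_eq_distr_Stream:
  "stream_space M = distr (M \<Otimes>\<^sub>M stream_space M) (stream_space M) (\<lambda>(x, s). x ## s)"
proof (rule measure_eqI)
  interpret S: prob_space "stream_space M" by (rule prob_space_stream_space)
  fix A assume A: "A \<in> sets (stream_space M)"
  note [measurable] = A
  let ?B = "(\<lambda>(x, s). x ## s) -` A \<inter> space (M \<Otimes>\<^sub>M stream_space M)"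
  have B: "?B \<in> sets (M \<Otimes>\<^sub>M stream_space M)" by measurable
  have "emeasure (distr (M \<Otimes>\<^sub>M stream_space M) (stream_space M) (\<lambda>(x, s). x ## s)) A =
      emeasure (M \<Otimes>\<^sub>M stream_space M) ?B"
    by (rule emeasure_distr) measurable
  also have "\<dots> = (\<integral>\<^sup>+x. emeasure (stream_space M) (Pair x -` ?B) \<partial>M)"
    by (rule S.emeasure_pair_measure_alt[OF B])
  also have "\<dots> = (\<integral>\<^sup>+x. emeasure (stream_space M) {s \<in> space (stream_space M). x ## s \<in> A} \<partial>M)"
    by (intro nn_integral_cong arg_cong[where f = "emeasure (stream_space M)"])
      (auto simp: space_pair_measure)
  also have "\<dots> = emeasure (stream_space M) A"
    by (rule emeasure_stream_space[symmetric]) fact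
  finally show "emeasure (stream_space M) A =
      emeasure (distr (M \<Otimes>\<^sub>M stream_space M) (stream_space M) (\<lambda>(x, s). x ## s)) A" ..
qed simp

text \<open>Split off the first toss: its two values, each of probability 1/2, turn
  \<open>cantor_point\<close> into the two branches of the invariance equation.\<close>

lemma is_mu4_cantor: "is_mu4 (distr coin_stream borel cantor_point)"
  unfolding is_mu4_def
proof (intro conjI ballI)
  let ?B = "measure_pmf (bernoulli_pmf (1 / 2))"
  interpret S: prob_space coin_stream
    unfolding coin_stream_def by (rule prob_space.prob_space_stream_space[OF prob_space_measure_pmf])
  interpret P: pair_prob_space ?B coin_stream ..
  show "prob_space (distr coin_stream borel cantor_point)"
    by (rule S.prob_space_distr) measurable
  fix f assume "f \<in> compactly_supported_continuous"
  then have f: "continuous_on UNIV f" "compact (closure {x. f x \<noteq> 0})"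
    by (auto simp: compactly_supported_continuous_def)
  have [measurable]: "f \<in> borel_measurable borel"
    using f(1) by (rule borel_measurable_continuous_onI)
  have "bounded (f ` closure {x. f x \<noteq> 0})"
    using f continuous_on_subset by (intro compact_imp_bounded compact_continuous_image) blast+
  then obtain C where C: "\<And>x. x \<in> closure {x. f x \<noteq> 0} \<Longrightarrow> cmod (f x) \<le> C"
    by (auto simp: bounded_iff)
  \<comment> \<open>\<open>C\<close> bounds \<open>f\<close> only on its closed support and may be
    negative if that is empty, hence the maximum with 0.\<close>
  have bnd: "cmod (f x) \<le> max 0 C" for x
    using C[of x] closure_subset[of "{x. f x \<noteq> 0}"] by (cases "f x = 0") auto
  have [measurable]: "(\<lambda>(b, s). b ## s) \<in> measurable (?B \<Otimes>\<^sub>M coin_stream) coin_stream"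
    unfolding coin_stream_def by measurable
  have "(LINT s|coin_stream. f (cantor_point s)) =
      (LINT s|distr (?B \<Otimes>\<^sub>M coin_stream) coin_stream (\<lambda>(b, s). b ## s). f (cantor_point s))"
    unfolding coin_stream_def
    by (intro arg_cong[where f = "\<lambda>M. LINT s|M. f (cantor_point s)"]
        prob_space.stream_space_eq_distr_Stream prob_space_measure_pmf)
  also have "\<dots> = (LINT z|(?B \<Otimes>\<^sub>M coin_stream). f (cantor_point (case z of (b, s) \<Rightarrow> b ## s)))"
    by (rule integral_distr) measurable
  also have "\<dots> = (LINT b|?B. LINT s|coin_stream. f (cantor_point (b ## s)))"
  proof -
    have "integrable (?B \<Otimes>\<^sub>M coin_stream) (\<lambda>z. f (cantor_point (case z of (b, s) \<Rightarrow> b ## s)))"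
      by (rule P.P.integrable_const_bound[of _ "max 0 C"]) (use bnd in auto)
    from P.integral_fst'[OF this] show ?thesis by simp
  qed
  also have "\<dots> = 1 / 2 * ((LINT s|coin_stream. f (cantor_point s / 4)) +
      (LINT s|coin_stream. f ((cantor_point s + 2) / 4)))"
    by (subst integral_measure_pmf[of UNIV])
      (auto simp: UNIV_bool cantor_point_Stream scaleR_conv_of_real algebra_simps)
  finally show "(LINT x|distr coin_stream borel cantor_point. f x) =
      1 / 2 * ((LINT x|distr coin_stream borel cantor_point. f (x / 4)) +
        (LINT x|distr coin_stream borel cantor_point. f ((x + 2) / 4)))"
    by (simp add: integral_distr)
qed simp

lemma is_mu4_mu4: "is_mu4 mu4"
  unfolding mu4_def
  by (rule theI[of is_mu4, OF is_mu4_cantor is_mu4_unique[OF _ is_mu4_cantor]])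

section \<open>Zeros of the Fourier transform\<close>

text \<open>If no cosine factor vanishes, a zero at \<open>l\<close> propagates to every
  \<open>l / 4 ^ n\<close>, against the limit 1. Conversely, for \<open>l = 4 ^ j * q\<close> the
  factor with index \<open>j\<close> is the cosine of an odd multiple of
  \<open>pi / 2\<close>.\<close>

lemma fourier_eq_0_iff:
  assumes "is_mu4 M"
  shows "fourier M l = 0 \<longleftrightarrow> (\<exists>j q. odd q \<and> l = real_of_int (4 ^ j * q))"
proof
  assume 0: "fourier M l = 0"
  show "\<exists>j q. odd q \<and> l = real_of_int (4 ^ j * q)"
  proof (rule ccontr)
    assume neg: "\<not> ?thesis"
    have "fourier M (l / 4 ^ n) = 0" for n
    proof (induction n)
      case (Suc n)
      have "cos (pi * (l / 4 ^ n) / 2) \<noteq> 0"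
      proof
        assume "cos (pi * (l / 4 ^ n) / 2) = 0"
        then obtain i where "odd i" "pi * (l / 4 ^ n) / 2 = of_int i * (pi / 2)"
          by (auto simp: cos_zero_iff_int)
        then have "odd i \<and> l = real_of_int (4 ^ n * i)"
          by (simp add: field_simps)
        with neg show False by blast
      qed
      then show ?case
        using norm_fourier_rec[OF assms, of "l / 4 ^ n"] Suc by (simp add: mult.commute)
    qed (use 0 in simp)
    then show False
      using fourier_contraction_limit[OF assms, of l] by (simp add: LIMSEQ_const_iff)
  qed
next
  assume "\<exists>j q. odd q \<and> l = real_of_int (4 ^ j * q)"
  then obtain j q where q: "odd q" and l: "l = real_of_int (4 ^ j * q)" by blast
  have "2 * pi * l / 4 ^ Suc j = of_int q * (pi / 2)"
    by (simp add: l)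
  then have "cos (2 * pi * l / 4 ^ Suc j) = 0"
    using q by (auto simp: cos_zero_iff_int)
  then show "fourier M l = 0"
    using norm_fourier_le_cos[OF assms, of l j] by simp
qed

lemma l2_inner_expo: "l2_inner M (expo l) (expo l') = fourier M (l - l')"
  by (simp add: l2_inner_def expo_mult_cnj fourier_def)

section \<open>Integers and their base 4 digits\<close>

lemma base4_quot_shift: "base4_quot k (Suc n) = base4_quot (k div 4) n"
  by (induction n) auto

lemma base4_digit_Suc: "base4_digit k (Suc n) = base4_digit (k div 4) n"
  by (simp only: base4_digit_def base4_quot_shift)

lemma base4_digit_bounds: "0 \<le> base4_digit k n" "base4_digit k n < 4"
  by (simp_all add: base4_digit_def)

lemma base4_quot_eq: "base4_quot k n = base4_digit k n + 4 * base4_quot k (Suc n)"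
  by (simp add: base4_digit_def)

lemma diff_eq_base4_quot_diff:
  assumes "\<And>i. i < n \<Longrightarrow> base4_digit k i = base4_digit k' i"
  shows "k - k' = 4 ^ n * (base4_quot k n - base4_quot k' n)"
  using assms
proof (induction n)
  case (Suc n)
  then have "k - k' = 4 ^ n * (base4_quot k n - base4_quot k' n)" by simp
  also have "base4_quot k n - base4_quot k' n = 4 * (base4_quot k (Suc n) - base4_quot k' (Suc n))"
    using base4_quot_eq[of k n] base4_quot_eq[of k' n] Suc.prems[of n] by simp
  finally show ?case by simp
qed simp

text \<open>The difference is divisible by every power of 4; the exponent
  \<open>\<bar>k - k'\<bar>\<close> already makes the power too large.\<close>

lemma base4_digit_inject:
  assumes "base4_digit k = base4_digit k'"
  shows "k = k'"
proof (rule ccontr)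
  assume "k \<noteq> k'"
  define n where "n = nat \<bar>k - k'\<bar>"
  have "4 ^ n dvd k - k'"
    using diff_eq_base4_quot_diff[of n k k'] assms by simp
  then have "\<bar>4 ^ n\<bar> \<le> \<bar>k - k'\<bar>"
    using \<open>k \<noteq> k'\<close> by (intro dvd_imp_le_int) auto
  moreover have "int n < 4 ^ n"
    using of_nat_less_two_power power_mono[of "2::int" 4 n] by (rule less_le_trans) auto
  ultimately show False by (simp add: n_def)
qed

lemma ends_in_offset: "ends_in (\<lambda>n. w (n + m)) d \<longleftrightarrow> ends_in w d"
proof
  assume "ends_in (\<lambda>n. w (n + m)) d"
  then obtain N where N: "\<And>n. n \<ge> N \<Longrightarrow> w (n + m) = d" by (auto simp: ends_in_def)
  have "w n = d" if "n \<ge> N + m" for n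
    using N[of "n - m"] that by simp
  then show "ends_in w d" by (auto simp: ends_in_def)
next
  assume "ends_in w d"
  then obtain N where "\<And>n. n \<ge> N \<Longrightarrow> w n = d" by (auto simp: ends_in_def)
  then have "\<forall>n\<ge>N. w (n + m) = d" by simp
  then show "ends_in (\<lambda>n. w (n + m)) d" unfolding ends_in_def by blast
qed

text \<open>Division by 4 decreases the absolute value except at its fixed points 0 and -1, whose
  digits are constantly 0 and 3.\<close>

lemma ends_in_base4_digit: "ends_in (base4_digit k) 0 \<or> ends_in (base4_digit k) 3"
proof (induction "nat \<bar>k\<bar>" arbitrary: k rule: less_induct)
  case less
  show ?case
  proof (cases "k = 0 \<or> k = - 1")
    case True
    have "base4_quot 0 n = 0" "base4_quot (- 1) n = - 1" for n by (induction n) auto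
    then show ?thesis using True by (auto simp: ends_in_def base4_digit_def)
  next
    case False
    then have "nat \<bar>k div 4\<bar> < nat \<bar>k\<bar>" by linarith
    from less[OF this] show ?thesis
      using ends_in_offset[of "base4_digit k" 1] by (simp add: base4_digit_Suc)
  qed
qed

lemma base4_digit_prepend:
  assumes "base4_digit k = (\<lambda>n. w (Suc n))" "0 \<le> w 0" "w 0 < 4"
  shows "base4_digit (w 0 + 4 * k) = w"
proof
  fix n
  show "base4_digit (w 0 + 4 * k) n = w n"
  proof (cases n)
    case 0
    then show ?thesis using assms by (simp add: base4_digit_def)
  next
    case (Suc m)
    then show ?thesis using assms by (simp add: base4_digit_Suc)
  qed
qed

text \<open>The constant tails 0 and 3 are the expansions of 0 and -1; the remaining digits are
  prepended one at a time.\<close>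

lemma ex_base4_digit_eq:
  assumes "\<And>n. 0 \<le> w n \<and> w n < 4" "ends_in w 0 \<or> ends_in w 3"
  shows "\<exists>k. base4_digit k = w"
proof -
  obtain N d where "d = 0 \<or> d = 3" "\<forall>n\<ge>N. w n = d"
    using assms(2) by (auto simp: ends_in_def)
  then show ?thesis
    using assms(1)
  proof (induction N arbitrary: w)
    case 0
    have "base4_quot 0 n = 0" "base4_quot (- 1) n = - 1" for n by (induction n) auto
    then have "base4_digit 0 = (\<lambda>_. 0)" "base4_digit (- 1) = (\<lambda>_. 3)"
      by (auto simp: base4_digit_def)
    moreover have "w = (\<lambda>_. d)" using 0 by auto
    ultimately show ?case using 0 by auto
  next
    case (Suc N)
    have "\<exists>k. base4_digit k = (\<lambda>n. w (Suc n))"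
      by (rule Suc.IH) (use Suc.prems in auto)
    then show ?case using base4_digit_prepend Suc.prems(3) by blast
  qed
qed

lemma base4_digit_sum:
  assumes "\<And>n. 0 \<le> w n \<and> w n < 4" "\<And>n. B \<le> n \<Longrightarrow> w n = 0"
  shows "base4_digit (\<Sum>n<B. w n * 4 ^ n) = w"
  using assms
proof (induction B arbitrary: w)
  case 0
  have "base4_quot 0 n = 0" for n by (induction n) auto
  then show ?case using 0 by (auto simp: base4_digit_def)
next
  case (Suc B)
  have "base4_digit (\<Sum>n<B. w (Suc n) * 4 ^ n) = (\<lambda>n. w (Suc n))"
    by (rule Suc.IH) (use Suc.prems in auto)
  from base4_digit_prepend[OF this] show ?case
    using Suc.prems(1)
    by (simp add: sum.lessThan_Suc_shift sum_distrib_left mult_ac del: sum.lessThan_Suc)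
qed

section \<open>Maximality for spectral labelings\<close>

lemma spectral_labelingD:
  assumes "spectral_labeling L"
  shows "0 \<le> L v b" "L v b < 4" "even (L v False) \<noteq> even (L v True)"
    "\<exists>p. ends_in (path_word L v p) 0 \<or> ends_in (path_word L v p) 3"
proof -
  have "L v b \<in> {0, 1, 2, 3}" using assms by (simp add: spectral_labeling_def)
  then show "0 \<le> L v b" "L v b < 4" by auto
qed (use assms in \<open>auto simp: spectral_labeling_def\<close>)

lemma even_label_iff:
  assumes "spectral_labeling L"
  shows "even (L v b) = even (L v b') \<longleftrightarrow> b = b'"
  using spectral_labelingD(3)[OF assms, of v] by (cases b; cases b') auto

lemma labeling_setI:
  assumes "path_word L [] p = base4_digit k"
  shows "k \<in> labeling_set L"
  using assms ends_in_base4_digit[of k] by (auto simp: labeling_set_def)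

text \<open>Up to the first differing choice \<open>n\<close> both paths visit the same vertices, so
  earlier digits agree. At \<open>n\<close> they leave a common vertex along edges of opposite
  parity, which makes the difference of the quotients odd.\<close>

lemma labeling_set_diff:
  assumes L: "spectral_labeling L" and k: "k \<in> labeling_set L" "k' \<in> labeling_set L" "k \<noteq> k'"
  shows "\<exists>j q. odd q \<and> k - k' = 4 ^ j * q"
proof -
  obtain p p' where p: "path_word L [] p = base4_digit k" and p': "path_word L [] p' = base4_digit k'"
    using k by (auto simp: labeling_set_def)
  have "p \<noteq> p'"
    using p p' k base4_digit_inject by metis
  then obtain n0 where "p n0 \<noteq> p' n0" by auto
  define n where "n = (LEAST n. p n \<noteq> p' n)"
  have n: "p n \<noteq> p' n"
    unfolding n_def using \<open>p n0 \<noteq> p' n0\<close> by (rule LeastI)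
  have less: "p i = p' i" if "i < n" for i
    using not_less_Least that unfolding n_def by blast
  have prefix: "map p [0..<i] = map p' [0..<i]" if "i \<le> n" for i
    using less that by auto
  have "base4_digit k i = base4_digit k' i" if "i < n" for i
    unfolding p[symmetric] p'[symmetric] path_word_def
    using less[OF that] prefix[of i] that by (simp del: map_eq_conv)
  then have "k - k' = 4 ^ n * (base4_quot k n - base4_quot k' n)"
    by (rule diff_eq_base4_quot_diff)
  moreover have "even (base4_digit k n) \<noteq> even (base4_digit k' n)"
    unfolding p[symmetric] p'[symmetric] path_word_def
    using even_label_iff[OF L] prefix[of n] n by (simp del: map_eq_conv)
  then have "odd (base4_quot k n - base4_quot k' n)"
    unfolding base4_digit_def by presburger
  ultimately show ?thesis by blast
qed

text \<open>Condition (ii) at the vertex reached after \<open>n\<close> choices supplies a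
  continuation \<open>q\<close>; the spliced path \<open>r\<close> reads the expansion of an
  integer.\<close>

lemma ex_labeling_set_prefix:
  assumes L: "spectral_labeling L"
  shows "\<exists>k\<in>labeling_set L. \<forall>i<n. base4_digit k i = path_word L [] p i"
proof -
  obtain q where q: "ends_in (path_word L (map p [0..<n]) q) 0 \<or>
      ends_in (path_word L (map p [0..<n]) q) 3"
    using spectral_labelingD(4)[OF L] by blast
  define r where "r i = (if i < n then p i else q (i - n))" for i
  have "map r [0..<i + n] = map p [0..<n] @ map q [0..<i]" for i
    by (rule nth_equalityI) (auto simp: r_def nth_append)
  then have "path_word L [] r (i + n) = path_word L (map p [0..<n]) q i" for i
    by (simp add: path_word_def r_def)
  then have "ends_in (path_word L [] r) 0 \<or> ends_in (path_word L [] r) 3"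
    using q ends_in_offset[of "path_word L [] r" n] by simp
  moreover have "0 \<le> path_word L [] r i \<and> path_word L [] r i < 4" for i
    using spectral_labelingD(1,2)[OF L] by (simp add: path_word_def)
  ultimately obtain k where k: "base4_digit k = path_word L [] r"
    using ex_base4_digit_eq by blast
  have "map r [0..<i] = map p [0..<i]" if "i < n" for i
    using that by (auto simp: r_def)
  then have "\<forall>i<n. base4_digit k i = path_word L [] p i"
    by (auto simp: k path_word_def r_def simp del: map_eq_conv)
  then show ?thesis using labeling_setI[OF k[symmetric]] by blast
qed

lemma ex_parity_path:
  assumes L: "spectral_labeling L"
  shows "\<exists>p. \<forall>n. even (path_word L [] p n) = even (w n :: int)"
proof -
  define c where "c v = (SOME b. even (L v b) = even (w (length v)))" for v
  have c: "even (L v (c v)) = even (w (length v))" for v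
    unfolding c_def by (rule someI_ex) (use spectral_labelingD(3)[OF L, of v] in metis)
  \<comment> \<open>\<open>pre n\<close> is the vertex at depth \<open>n\<close> of the path that
    always takes the edge of the prescribed parity.\<close>
  define pre where "pre = rec_nat [] (\<lambda>_ v. v @ [c v])"
  have pre: "map (\<lambda>n. c (pre n)) [0..<n] = pre n" for n
    by (induction n) (auto simp: pre_def)
  have "length (pre n) = n" for n
    by (induction n) (auto simp: pre_def)
  then have "even (path_word L [] (\<lambda>n. c (pre n)) n) = even (w n)" for n
    using c[of "pre n"] by (simp add: path_word_def pre)
  then show ?thesis by blast
qed

text \<open>The 2-adic valuation is odd on the left, as \<open>u\<close> contributes exactly one
  factor 2, and even on the right.\<close>

lemma power4_mult_neq:
  fixes u q :: int
  assumes "u mod 4 = 2" "odd q"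
  shows "4 ^ n * u \<noteq> 4 ^ j * q"
proof
  assume eq: "4 ^ n * u = 4 ^ j * q"
  have "even u" using assms(1) by presburger
  show False
  proof (cases "j \<le> n")
    case True
    then have "4 ^ j * (4 ^ (n - j) * u) = 4 ^ j * q"
      using eq by (simp flip: mult.assoc power_add)
    then have "4 ^ (n - j) * u = q" by simp
    with \<open>even u\<close> assms(2) show False by auto
  next
    case False
    then have "4 ^ n * (4 ^ (j - n) * q) = 4 ^ n * u"
      using eq by (simp flip: mult.assoc power_add)
    then have "u = 4 ^ (j - n) * q" by simp
    moreover have "(4 :: int) dvd 4 ^ (j - n)" using False by (simp add: dvd_power)
    ultimately have "4 dvd u" by simp
    with assms(1) show False by (simp add: dvd_eq_mod_eq_0)
  qed
qed

text \<open>Follow the path whose labels have the parities of the digits of \<open>k\<close>. At the first place where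
  label and digit disagree they differ by \<open>2\<close>, and any completion of this finite path gives an
  element whose difference to \<open>k\<close> has odd 2-adic valuation.\<close>

lemma labeling_set_complement:
  assumes L: "spectral_labeling L" and k: "k \<notin> labeling_set L"
  shows "\<exists>k'\<in>labeling_set L. \<not> (\<exists>j q. odd q \<and> k - k' = 4 ^ j * q)"
proof -
  obtain p where p: "\<And>n. even (path_word L [] p n) = even (base4_digit k n)"
    using ex_parity_path[OF L] by blast
  obtain n0 where "base4_digit k n0 \<noteq> path_word L [] p n0"
    using k labeling_setI[of L p k] by fastforce
  define n where "n = (LEAST n. base4_digit k n \<noteq> path_word L [] p n)"
  have n: "base4_digit k n \<noteq> path_word L [] p n"
    unfolding n_def using \<open>base4_digit k n0 \<noteq> path_word L [] p n0\<close> by (rule LeastI)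
  have less: "base4_digit k i = path_word L [] p i" if "i < n" for i
    using not_less_Least that unfolding n_def by blast
  obtain k' where k': "k' \<in> labeling_set L" "\<And>i. i \<le> n \<Longrightarrow> base4_digit k' i = path_word L [] p i"
    using ex_labeling_set_prefix[OF L, of "Suc n" p] by (auto simp: less_Suc_eq_le)
  let ?u = "base4_quot k n - base4_quot k' n"
  have diff: "k - k' = 4 ^ n * ?u"
    by (rule diff_eq_base4_quot_diff) (simp add: less k')
  have "even (base4_digit k n) = even (base4_digit k' n)" "base4_digit k n \<noteq> base4_digit k' n"
    using p[of n] n k'(2)[of n] by auto
  then have "(base4_digit k n - base4_digit k' n) mod 4 = 2"
    using base4_digit_bounds[of k n] base4_digit_bounds[of k' n] by presburger
  then have "?u mod 4 = 2"
    using base4_quot_eq[of k n] base4_quot_eq[of k' n] by presburger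
  then show ?thesis
    using diff k'(1) power4_mult_neq by metis
qed

theorem spectral_labeling_maximal:
  assumes M: "is_mu4 M" and L: "spectral_labeling L"
  shows "maximal_orthogonal_exponentials M (real_of_int ` labeling_set L)"
proof -
  have zero_iff: "l2_inner M (expo (real_of_int k)) (expo (real_of_int k')) = 0 \<longleftrightarrow>
      (\<exists>j q. odd q \<and> k - k' = 4 ^ j * q)" for k k'
    unfolding l2_inner_expo fourier_eq_0_iff[OF M] of_int_diff[symmetric] of_int_eq_iff ..
  have "orthogonal_exponentials M (real_of_int ` labeling_set L)"
    using labeling_set_diff[OF L]
    by (auto simp: orthogonal_exponentials_def pairwise_def zero_iff)
  moreover have "l' \<in> real_of_int ` labeling_set L"
    if orth: "\<And>l. l \<in> real_of_int ` labeling_set L \<Longrightarrow> l2_inner M (expo l') (expo l) = 0" for l'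
  proof -
    \<comment> \<open>Orthogonality to a single element already forces the real frequency
      \<open>l'\<close> to be an integer.\<close>
    obtain k0 where "k0 \<in> labeling_set L"
      using ex_labeling_set_prefix[OF L] by blast
    then have "fourier M (l' - real_of_int k0) = 0"
      using orth by (simp add: l2_inner_expo)
    then obtain z :: int where "l' - real_of_int k0 = real_of_int z"
      using fourier_eq_0_iff[OF M] by blast
    then have l': "l' = real_of_int (z + k0)" by simp
    have "z + k0 \<in> labeling_set L"
      using labeling_set_complement[OF L, of "z + k0"] orth zero_iff unfolding l' by blast
    then show ?thesis using l' by blast
  qed
  ultimately show ?thesis
    unfolding maximal_orthogonal_exponentials_def by blast
qed

section \<open>The labeling\<close>

text \<open>The element of \<open>Lam\<close> whose coefficient sequence is the indicator function
  of \<open>A\<close>, with the products multiplied out.\<close>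

definition lam :: "nat set \<Rightarrow> int" where
  "lam A = (\<Sum>k\<in>A. 4 ^ k + 4 ^ 10 ^ (k + 2))"

text \<open>The positions \<open>k\<close> and \<open>10 ^ (k + 2)\<close> of the digits that \<open>k \<in> A\<close> contributes may
  coincide with positions contributed by another element of \<open>A\<close>, but at most two contributions
  meet, so that no carry occurs.\<close>

definition lam_word :: "nat set \<Rightarrow> nat \<Rightarrow> int" where
  "lam_word A n = of_bool (n \<in> A) + of_bool (\<exists>m\<in>A. n = 10 ^ (m + 2))"

text \<open>The second summand depends only on the vertex, so its two edges carry \<open>s\<close>
  and \<open>s + 1\<close> with \<open>s\<close> in {0, 1}. It consults only choices already made,
  which suffices because \<open>m < 10 ^ (m + 2)\<close>.\<close>

definition lam_labeling :: edge_labeling where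
  "lam_labeling v b = of_bool b + of_bool (\<exists>m<length v. v ! m \<and> length v = 10 ^ (m + 2))"

lemma less_10_power: "m < (10::nat) ^ (m + 2)"
  by (induction m) auto

lemma Lam_eq: "Lam = lam ` {A. finite A}"
proof -
  have coeff: "4 ^ k * (4 ^ (10 ^ (k + 2) - k) + 1) = (4 ^ k + 4 ^ 10 ^ (k + 2) :: int)" for k
    using less_10_power[of k] by (simp add: distrib_left flip: power_add)
  show ?thesis
  proof (intro equalityI subsetI)
    fix x assume "x \<in> Lam"
    then obtain N and \<delta> :: "nat \<Rightarrow> int" where \<delta>: "\<And>k. \<delta> k \<in> {0, 1}"
      and x: "x = (\<Sum>k\<le>N. 4 ^ k * (4 ^ (10 ^ (k + 2) - k) + 1) * \<delta> k)"
      unfolding Lam_def by blast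
    have "x = (\<Sum>k\<le>N. if \<delta> k = 1 then 4 ^ k + 4 ^ 10 ^ (k + 2) else 0)"
      unfolding x coeff using \<delta> by (intro sum.cong) force+
    also have "\<dots> = lam {k \<in> {..N}. \<delta> k = 1}"
      unfolding lam_def by (rule sum.inter_filter[symmetric]) simp
    finally show "x \<in> lam ` {A. finite A}" by auto
  next
    fix x assume "x \<in> lam ` {A. finite A}"
    then obtain A where A: "finite A" "x = lam A" by blast
    \<comment> \<open>Inserting 0 keeps \<open>Max\<close> meaningful when \<open>A\<close> is
      empty.\<close>
    define N where "N = Max (insert 0 A)"
    have "A \<subseteq> {..N}" using A(1) by (auto simp: N_def)
    then have "x = (\<Sum>k\<le>N. if k \<in> A then 4 ^ k + 4 ^ 10 ^ (k + 2) else 0)"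
      unfolding A(2) lam_def by (intro sum.mono_neutral_cong_left) auto
    also have "\<dots> = (\<Sum>k\<le>N. 4 ^ k * (4 ^ (10 ^ (k + 2) - k) + 1) * of_bool (k \<in> A))"
      unfolding coeff by (intro sum.cong) auto
    finally show "x \<in> Lam"
      unfolding Lam_def by (intro CollectI exI[of _ N] exI[of _ "\<lambda>k. of_bool (k \<in> A)"]) auto
  qed
qed

lemma lam_word_eq_0:
  assumes "A \<subseteq> {..<N}" "10 ^ (N + 2) \<le> n"
  shows "lam_word A n = 0"
proof -
  have "N < n" using less_10_power[of N] assms(2) by linarith
  moreover have "n \<noteq> 10 ^ (m + 2)" if "m \<in> A" for m
  proof -
    have "(10::nat) ^ (m + 2) < 10 ^ (N + 2)"
      using assms(1) that by (intro power_strict_increasing) auto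
    then show ?thesis using assms(2) by linarith
  qed
  ultimately show ?thesis using assms(1) by (auto simp: lam_word_def)
qed

text \<open>Since \<open>m\<close> determines \<open>10 ^ (m + 2)\<close> injectively, each position
  receives at most one contribution of each kind, so the coefficients are at most 2 and are the
  digits.\<close>

lemma base4_digit_lam:
  assumes "finite A"
  shows "base4_digit (lam A) = lam_word A"
proof -
  obtain N where N: "A \<subseteq> {..<N}"
    using assms finite_nat_iff_bounded by blast
  define B :: nat where "B = 10 ^ (N + 2)"
  have AB: "A \<subseteq> {..<B}"
    using N less_10_power[of N] by (auto simp: B_def)
  have pAB: "(\<lambda>m. 10 ^ (m + 2)) ` A \<subseteq> {..<B}"
    using N unfolding B_def by (auto intro!: power_strict_increasing)
  have "(\<Sum>n<B. lam_word A n * 4 ^ n) =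
      (\<Sum>n<B. of_bool (n \<in> A) * 4 ^ n) + (\<Sum>n<B. of_bool (n \<in> (\<lambda>m. 10 ^ (m + 2)) ` A) * 4 ^ n)"
    unfolding lam_word_def sum.distrib[symmetric]
    by (intro sum.cong refl) (auto simp: distrib_right image_iff)
  also have "(\<Sum>n<B. of_bool (n \<in> A) * 4 ^ n) = (\<Sum>n\<in>A. 4 ^ n :: int)"
    using AB by (intro sum.mono_neutral_cong_right) auto
  also have "(\<Sum>n<B. of_bool (n \<in> (\<lambda>m. 10 ^ (m + 2)) ` A) * 4 ^ n) =
      (\<Sum>n\<in>(\<lambda>m. 10 ^ (m + 2)) ` A. 4 ^ n :: int)"
    using pAB by (intro sum.mono_neutral_cong_right) auto
  also have "\<dots> = (\<Sum>m\<in>A. 4 ^ 10 ^ (m + 2))"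
    by (subst sum.reindex) (auto intro: inj_onI)
  finally have "lam A = (\<Sum>n<B. lam_word A n * 4 ^ n)"
    by (simp add: lam_def sum.distrib)
  moreover have "base4_digit (\<Sum>n<B. lam_word A n * 4 ^ n) = lam_word A"
    by (rule base4_digit_sum) (use lam_word_eq_0[OF N] in \<open>auto simp: lam_word_def B_def\<close>)
  ultimately show ?thesis by simp
qed

lemma path_word_lam_labeling: "path_word lam_labeling [] p = lam_word {n. p n}"
proof
  fix n
  have "(\<exists>m<n. p m \<and> n = 10 ^ (m + 2)) \<longleftrightarrow> (\<exists>m. p m \<and> n = 10 ^ (m + 2))"
    using less_10_power by blast
  moreover have "(\<exists>m<n. map p [0..<n] ! m \<and> n = 10 ^ (m + 2)) \<longleftrightarrow> (\<exists>m<n. p m \<and> n = 10 ^ (m + 2))"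
    by auto
  ultimately show "path_word lam_labeling [] p n = lam_word {n. p n} n"
    by (simp add: path_word_def lam_labeling_def lam_word_def)
qed

text \<open>From any vertex \<open>v\<close>, choose \<open>False\<close> forever: the remaining
  nonzero labels stem from choices inside \<open>v\<close>, and these act only at depths below
  \<open>10 ^ (length v + 2)\<close>.\<close>

lemma spectral_labeling_lam: "spectral_labeling lam_labeling"
proof -
  have "\<exists>p. ends_in (path_word lam_labeling v p) 0" for v
  proof -
    have "path_word lam_labeling v (\<lambda>_. False) n = 0" if n: "10 ^ (length v + 2) \<le> n" for n
    proof -
      have "False" if m: "m < length v + n" "(v @ map (\<lambda>_. False) [0..<n]) ! m"
        "length v + n = 10 ^ (m + 2)" for m
      proof -
        have "m < length v" using m by (auto simp: nth_append split: if_splits)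
        then have "(10::nat) ^ (m + 2) < 10 ^ (length v + 2)"
          by (intro power_strict_increasing) auto
        with m(3) n show False by linarith
      qed
      then have "\<not> (\<exists>m<length v + n. (v @ map (\<lambda>_. False) [0..<n]) ! m \<and> length v + n = 10 ^ (m + 2))"
        by blast
      then show ?thesis
        by (simp add: path_word_def lam_labeling_def del: power_Suc add_2_eq_Suc')
    qed
    then show ?thesis unfolding ends_in_def by blast
  qed
  then show ?thesis
    unfolding spectral_labeling_def by (auto simp: lam_labeling_def)
qed

text \<open>Labels never equal 3, and each choice \<open>True\<close> gives a nonzero label. Hence
  an admissible path ends in zeros and has finitely many such choices, whose positions form the
  finite set sought.\<close>

lemma labeling_set_lam: "labeling_set lam_labeling = Lam"
proof (intro equalityI subsetI)
  fix k assume "k \<in> Lam"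
  then obtain A where "finite A" "k = lam A" by (auto simp: Lam_eq)
  then have "path_word lam_labeling [] (\<lambda>n. n \<in> A) = base4_digit k"
    by (simp add: path_word_lam_labeling base4_digit_lam)
  then show "k \<in> labeling_set lam_labeling" by (rule labeling_setI)
next
  fix k assume "k \<in> labeling_set lam_labeling"
  then obtain p where k: "base4_digit k = lam_word {n. p n}"
    and ends: "ends_in (lam_word {n. p n}) 0 \<or> ends_in (lam_word {n. p n}) 3"
    unfolding labeling_set_def path_word_lam_labeling mem_Collect_eq by metis
  have "\<not> ends_in (lam_word {n. p n}) 3"
    by (auto simp: ends_in_def lam_word_def)
  then obtain N where N: "\<And>n. n \<ge> N \<Longrightarrow> lam_word {n. p n} n = 0"
    using ends by (auto simp: ends_in_def)
  have "\<not> p n" if "n \<ge> N" for n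
    using N[OF that] by (auto simp: lam_word_def of_bool_def split: if_splits)
  then have "{n. p n} \<subseteq> {..<N}" by (auto simp: not_le[symmetric])
  then have fin: "finite {n. p n}" using finite_subset by blast
  then have "k = lam {n. p n}"
    using k base4_digit_lam base4_digit_inject by metis
  then show "k \<in> Lam" using fin by (auto simp: Lam_eq)
qed

section \<open>Failure of completeness\<close>

lemma lam_mono: "finite B \<Longrightarrow> A \<subseteq> B \<Longrightarrow> lam A \<le> lam B"
  unfolding lam_def by (rule sum_mono2) auto

lemma lam_lessThan_le: "lam {..<N} \<le> 4 ^ (10 ^ (N + 1) + 1)"
proof (induction N)
  case (Suc N)
  have "lam {..<Suc N} = lam {..<N} + (4 ^ N + 4 ^ 10 ^ (N + 2))"
    by (simp add: lam_def)
  also have "\<dots> \<le> 4 ^ 10 ^ (N + 2) + (4 ^ 10 ^ (N + 2) + 4 ^ 10 ^ (N + 2))"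
  proof (intro add_mono order.refl)
    have "(4::int) ^ (10 ^ (N + 1) + 1) \<le> 4 ^ 10 ^ (N + 2)"
      by (intro power_increasing) auto
    then show "lam {..<N} \<le> 4 ^ 10 ^ (N + 2)" using Suc.IH by linarith
    show "(4::int) ^ N \<le> 4 ^ 10 ^ (N + 2)"
      using less_10_power[of N] by (intro power_increasing) auto
  qed
  also have "\<dots> \<le> 4 ^ (10 ^ (N + 2) + 1)" by simp
  finally show ?case by simp
qed (simp add: lam_def)

text \<open>The digit \<open>1\<close> of \<open>lam (insert N A)\<close> at position \<open>E = 10 ^ (N + 2)\<close> is preceded by a very long
  block of zeros, which puts the cosine factor with denominator \<open>4 ^ (E + 1)\<close> close to its zero.\<close>

lemma norm_fourier_lam_le:
  assumes M: "is_mu4 M" and A: "A \<subseteq> {..<N}"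
  shows "(cmod (fourier M (1 - real_of_int (lam (insert N A)))))\<^sup>2 \<le> (1 / 4) ^ Suc N"
proof -
  define E :: nat where "E = 10 ^ (N + 2)"
  define r where "r = 4 ^ N + lam A - 1"
  have fin: "finite A" using A finite_subset by blast
  have lam: "lam (insert N A) = 4 ^ E + r + 1"
    unfolding lam_def r_def E_def using A fin by (subst sum.insert) auto
  have r_nonneg: "0 \<le> r"
  proof -
    have "0 \<le> lam A" unfolding lam_def by (rule sum_nonneg) simp
    moreover have "(1::int) \<le> 4 ^ N" by (rule one_le_power) simp
    ultimately show ?thesis unfolding r_def by linarith
  qed
  \<comment> \<open>The exponent of \<open>r\<close> is at most \<open>10 ^ (N + 1) + 2\<close>,
    while \<open>E\<close> is ten times \<open>10 ^ (N + 1)\<close>; the gap absorbs the factor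
    \<open>2 ^ (N + 2)\<close>.\<close>
  have "r * 2 ^ (N + 2) \<le> 4 ^ E"
  proof -
    have exps: "m + 3 < (10::nat) ^ (m + 1)" for m by (induction m) auto
    note exps = this[of N]
    have "r \<le> 4 ^ N + 4 ^ (10 ^ (N + 1) + 1)"
      using lam_mono[OF _ A] lam_lessThan_le[of N] by (simp add: r_def)
    also have "(4::int) ^ N \<le> 4 ^ (10 ^ (N + 1) + 1)"
      using exps by (intro power_increasing) auto
    also have "(4::int) ^ (10 ^ (N + 1) + 1) + 4 ^ (10 ^ (N + 1) + 1) \<le> 4 ^ (10 ^ (N + 1) + 2)"
      by simp
    finally have "r \<le> 4 ^ (10 ^ (N + 1) + 2)" by simp
    then have "r * 2 ^ (N + 2) \<le> 4 ^ (10 ^ (N + 1) + 2) * 4 ^ (N + 2)"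
      using r_nonneg by (intro mult_mono power_mono) auto
    also have "\<dots> = 4 ^ (10 ^ (N + 1) + 2 + (N + 2))"
      by (simp only: power_add)
    also have "\<dots> \<le> 4 ^ E"
      unfolding E_def using exps by (intro power_increasing) auto
    finally show ?thesis .
  qed
  then have "real_of_int (r * 2 ^ (N + 2)) \<le> real_of_int (4 ^ E)"
    by (simp only: of_int_le_iff)
  then have r_le: "real_of_int r / 4 ^ E \<le> 1 / 2 ^ (N + 2)"
    by (simp add: field_simps)
  \<comment> \<open>Up to sign, the argument of the chosen cosine is \<open>y + pi / 2\<close>: the
    power \<open>4 ^ E\<close> gives exactly \<open>pi / 2\<close>, and \<open>y\<close> is the
    error caused by \<open>r\<close>.\<close>
  define y where "y = 2 * pi * r / 4 ^ Suc E"
  have "0 \<le> y" using r_nonneg by (simp add: y_def)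
  have "y \<le> 2 * (real_of_int r / 4 ^ E)"
    using mult_right_mono[OF less_imp_le[OF pi_less_4], of "2 * (real_of_int r / 4 ^ E) / 4"] r_nonneg
    by (simp add: y_def)
  also have "\<dots> \<le> (1 / 2) ^ Suc N"
    using r_le by (simp add: power_divide)
  finally have y_le: "y \<le> (1 / 2) ^ Suc N" .
  have "cmod (fourier M (1 - real_of_int (lam (insert N A)))) \<le>
      \<bar>cos (2 * pi * (1 - real_of_int (lam (insert N A))) / 4 ^ Suc E)\<bar>"
    by (rule norm_fourier_le_cos[OF M])
  also have "2 * pi * (1 - real_of_int (lam (insert N A))) / 4 ^ Suc E = - (y + pi / 2)"
    by (simp add: lam y_def field_simps)
  also have "cos (- (y + pi / 2)) = - sin y"
    unfolding cos_minus by (simp add: cos_add)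
  also have "\<bar>- sin y\<bar> \<le> \<bar>y\<bar>"
    by (simp add: abs_sin_x_le_abs_x)
  also have "\<dots> \<le> (1 / 2) ^ Suc N"
    using y_le \<open>0 \<le> y\<close> by simp
  finally have "(cmod (fourier M (1 - real_of_int (lam (insert N A)))))\<^sup>2 \<le> ((1 / 2) ^ Suc N)\<^sup>2"
    by (intro power_mono) auto
  also have "\<dots> = (1 / 4) ^ Suc N"
    unfolding power2_eq_square power_mult_distrib[symmetric] by simp
  finally show ?thesis .
qed

text \<open>The empty set contributes 0. Passing to \<open>Suc N\<close> adds \<open>2 ^ N\<close>
  sets containing \<open>N\<close>, each contributing at most \<open>(1 / 4) ^ Suc N\<close>, which
  gives a geometric series of total 1/2.\<close>

lemma sum_norm_fourier_lam_le:
  assumes "is_mu4 M"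
  shows "(\<Sum>A\<in>Pow {..<N}. (cmod (fourier M (1 - real_of_int (lam A))))\<^sup>2) \<le> (1 - (1 / 2) ^ N) / 2"
proof (induction N)
  case 0
  have "fourier M 1 = 0"
    unfolding fourier_eq_0_iff[OF assms] by (intro exI[of _ 0] exI[of _ 1]) simp
  then show ?case by (simp add: lam_def)
next
  case (Suc N)
  let ?f = "\<lambda>A. (cmod (fourier M (1 - real_of_int (lam A))))\<^sup>2"
  have "(\<Sum>A\<in>Pow {..<Suc N}. ?f A) = (\<Sum>A\<in>Pow {..<N}. ?f A) + (\<Sum>A\<in>insert N ` Pow {..<N}. ?f A)"
    unfolding lessThan_Suc Pow_insert by (rule sum.union_disjoint) auto
  also have "(\<Sum>A\<in>insert N ` Pow {..<N}. ?f A) = (\<Sum>A\<in>Pow {..<N}. ?f (insert N A))"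
    by (subst sum.reindex) (auto simp: inj_on_def insert_ident subset_iff)
  also have "\<dots> \<le> (\<Sum>A\<in>Pow {..<N}. (1 / 4) ^ Suc N)"
    by (intro sum_mono norm_fourier_lam_le assms) auto
  also have "\<dots> = (1 / 2) ^ N / 4"
  proof -
    have "(2::real) ^ N * (1 / 4) ^ N = (1 / 2) ^ N"
      by (simp flip: power_mult_distrib)
    then show ?thesis by (simp add: card_Pow)
  qed
  finally show ?case using Suc.IH by simp
qed

text \<open>Bessel's best approximation bound: with \<open>a l\<close> the Fourier coefficients of
  \<open>expo t\<close>, completing the square shows that the error exceeds the left side by the sum
  of the \<open>(cmod (c l - a l))\<^sup>2\<close>.\<close>

lemma norm_expo_minus_sum_ge:
  assumes M: "is_mu4 M" and S: "finite S" "orthogonal_exponentials M S"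
  shows "1 - (\<Sum>l\<in>S. (cmod (fourier M (t - l)))\<^sup>2) \<le>
    (LINT x|M. (cmod (expo t x - (\<Sum>l\<in>S. c l * expo l x)))\<^sup>2)"
proof -
  interpret real_distribution M using M by (rule is_mu4_real_distribution)
  have int [simp]: "integrable M (expo l)" for l
    by (rule integrable_const_bound[of _ 1]) auto
  then have int_cnj [simp]: "integrable M (\<lambda>x. cnj (expo l x))" for l by simp
  have orth: "fourier M (l - l') = of_bool (l = l')" if "l \<in> S" "l' \<in> S" for l l'
    using S(2) that fourier_0[OF M]
    by (auto simp: orthogonal_exponentials_def pairwise_def l2_inner_expo)
  define a where "a l = fourier M (t - l)" for l
  define g where "g x = expo t x - (\<Sum>l\<in>S. c l * expo l x)" for x
  have g: "complex_of_real ((cmod (g x))\<^sup>2) = expo 0 x - (\<Sum>l\<in>S. cnj (c l) * expo (t - l) x)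
      - (\<Sum>l\<in>S. c l * cnj (expo (t - l) x)) + (\<Sum>l\<in>S. \<Sum>l'\<in>S. c l * cnj (c l') * expo (l - l') x)" for x
  proof -
    have "complex_of_real ((cmod (g x))\<^sup>2) = g x * cnj (g x)"
      by (rule complex_norm_square)
    also have "\<dots> = expo t x * cnj (expo t x)
        - expo t x * (\<Sum>l\<in>S. cnj (c l) * cnj (expo l x))
        - (\<Sum>l\<in>S. c l * expo l x) * cnj (expo t x)
        + (\<Sum>l\<in>S. c l * expo l x) * (\<Sum>l\<in>S. cnj (c l) * cnj (expo l x))"
      by (simp add: g_def left_diff_distrib right_diff_distrib)
    also have "expo t x * (\<Sum>l\<in>S. cnj (c l) * cnj (expo l x)) =
        (\<Sum>l\<in>S. cnj (c l) * (expo t x * cnj (expo l x)))"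
      by (simp add: sum_distrib_left mult_ac)
    also have "(\<Sum>l\<in>S. c l * expo l x) * cnj (expo t x) =
        (\<Sum>l\<in>S. c l * cnj (expo t x * cnj (expo l x)))"
      unfolding sum_distrib_right by (intro sum.cong refl) (simp add: mult_ac)
    also have "(\<Sum>l\<in>S. c l * expo l x) * (\<Sum>l\<in>S. cnj (c l) * cnj (expo l x)) =
        (\<Sum>l\<in>S. \<Sum>l'\<in>S. c l * cnj (c l') * (expo l x * cnj (expo l' x)))"
      by (simp add: sum_product mult_ac)
    finally show ?thesis by (simp only: expo_mult_cnj diff_self)
  qed
  have "complex_of_real (LINT x|M. (cmod (g x))\<^sup>2) = (LINT x|M. complex_of_real ((cmod (g x))\<^sup>2))"
    by (rule integral_complex_of_real[symmetric])
  also have "\<dots> = 1 - (\<Sum>l\<in>S. cnj (c l) * a l) - (\<Sum>l\<in>S. c l * cnj (a l))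
      + (\<Sum>l\<in>S. \<Sum>l'\<in>S. c l * cnj (c l') * of_bool (l = l'))"
  proof -
    have "(\<Sum>l\<in>S. \<Sum>l'\<in>S. c l * cnj (c l') * of_bool (l = l')) =
        (\<Sum>l\<in>S. \<Sum>l'\<in>S. c l * cnj (c l') * fourier M (l - l'))"
      using orth by (intro sum.cong) auto
    then show ?thesis
      unfolding g a_def using fourier_0[OF M] by (simp add: fourier_def)
  qed
  also have "(\<Sum>l\<in>S. \<Sum>l'\<in>S. c l * cnj (c l') * of_bool (l = l')) = (\<Sum>l\<in>S. c l * cnj (c l))"
    using S(1) by (intro sum.cong refl) (simp add: of_bool_def if_distrib sum.delta' cong: if_cong)
  \<comment> \<open>The square is completed here, separately for each \<open>l\<close>.\<close>
  also have "1 - (\<Sum>l\<in>S. cnj (c l) * a l) - (\<Sum>l\<in>S. c l * cnj (a l)) + (\<Sum>l\<in>S. c l * cnj (c l)) =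
      1 - (\<Sum>l\<in>S. a l * cnj (a l)) + (\<Sum>l\<in>S. (c l - a l) * cnj (c l - a l))"
    by (simp add: algebra_simps sum.distrib sum_subtractf)
  also have "\<dots> = complex_of_real (1 - (\<Sum>l\<in>S. (cmod (a l))\<^sup>2) + (\<Sum>l\<in>S. (cmod (c l - a l))\<^sup>2))"
    by (simp only: complex_norm_square[symmetric] of_real_sum of_real_diff of_real_add of_real_1)
  finally have "(LINT x|M. (cmod (g x))\<^sup>2) =
      1 - (\<Sum>l\<in>S. (cmod (a l))\<^sup>2) + (\<Sum>l\<in>S. (cmod (c l - a l))\<^sup>2)"
    by (simp only: of_real_eq_iff)
  moreover have "0 \<le> (\<Sum>l\<in>S. (cmod (c l - a l))\<^sup>2)" by (intro sum_nonneg) simp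
  ultimately show ?thesis unfolding a_def g_def by simp
qed

text \<open>A spectrum would approximate \<open>expo 1\<close> with squared error below 1/4, whereas
  the coefficients bound that error below by 1/2.\<close>

lemma not_spectrum_Lam:
  assumes M: "is_mu4 M" and orth: "orthogonal_exponentials M (real_of_int ` Lam)"
  shows "\<not> is_spectrum M (real_of_int ` Lam)"
proof
  interpret real_distribution M using M by (rule is_mu4_real_distribution)
  assume "is_spectrum M (real_of_int ` Lam)"
  moreover have "square_integrable M (expo 1)"
    by (simp add: square_integrable_def)
  ultimately obtain F c where F: "finite F" "F \<subseteq> expo ` real_of_int ` Lam"
    and less: "l2_norm M (\<lambda>x. expo 1 x - (\<Sum>b\<in>F. c b * b x)) < 1 / 2"
    unfolding is_spectrum_def orthonormal_basis_L2_def
    by (elim conjE allE[of _ "expo 1"] impE allE[of _ "1 / 2 :: real"]) auto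
  have "F \<subseteq> (\<lambda>A. expo (real_of_int (lam A))) ` {A. finite A}"
    using F(2) by (simp add: Lam_eq image_image)
  \<comment> \<open>One finite index set is selected for each exponential in \<open>F\<close>, so
    that reindexing is injective.\<close>
  then obtain \<A> where \<A>: "\<A> \<subseteq> {A. finite A}" "inj_on (\<lambda>A. expo (real_of_int (lam A))) \<A>"
      "F = (\<lambda>A. expo (real_of_int (lam A))) ` \<A>"
    by (auto simp: subset_image_inj)
  have fin: "finite \<A>" using F(1) \<A>(2) unfolding \<A>(3) by (simp add: finite_image_iff)
  then have "finite (\<Union>\<A>)" using \<A>(1) by auto
  \<comment> \<open>All index sets lie in one \<open>{..<N}\<close>, so the sum over
    \<open>S\<close> is part of the sum over \<open>Pow {..<N}\<close> already bounded.\<close>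
  then obtain N where N: "\<Union>\<A> \<subseteq> {..<N}"
    using finite_nat_iff_bounded by blast
  have inj: "inj_on (\<lambda>A. real_of_int (lam A)) \<A>"
    using \<A>(2) unfolding inj_on_def by auto
  define S where "S = (\<lambda>A. real_of_int (lam A)) ` \<A>"
  have F_eq: "F = expo ` S" by (simp add: \<A>(3) S_def image_image)
  have "S \<subseteq> real_of_int ` Lam" using \<A>(1) by (auto simp: S_def Lam_eq)
  then have "orthogonal_exponentials M S"
    using orth pairwise_subset unfolding orthogonal_exponentials_def by blast
  then have "1 - (\<Sum>l\<in>S. (cmod (fourier M (1 - l)))\<^sup>2) \<le>
      (LINT x|M. (cmod (expo 1 x - (\<Sum>l\<in>S. c (expo l) * expo l x)))\<^sup>2)"
    using norm_expo_minus_sum_ge[OF M] fin by (simp add: S_def)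
  also have "(\<lambda>x. \<Sum>l\<in>S. c (expo l) * expo l x) = (\<lambda>x. \<Sum>b\<in>F. c b * b x)"
    unfolding F_eq by (subst sum.reindex) (auto intro: inj_on_subset[OF inj_expo])
  then have "(LINT x|M. (cmod (expo 1 x - (\<Sum>l\<in>S. c (expo l) * expo l x)))\<^sup>2) =
      (LINT x|M. (cmod (expo 1 x - (\<Sum>b\<in>F. c b * b x)))\<^sup>2)"
    by (simp only: fun_eq_iff)
  also have "\<dots> < (1 / 2)\<^sup>2"
    using less real_sqrt_less_iff[of _ "(1 / 2)\<^sup>2"] unfolding l2_norm_def by simp
  finally have "1 - (\<Sum>l\<in>S. (cmod (fourier M (1 - l)))\<^sup>2) < 1 / 4"
    by (simp add: power2_eq_square)
  moreover have "(\<Sum>l\<in>S. (cmod (fourier M (1 - l)))\<^sup>2) \<le>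
      (\<Sum>A\<in>Pow {..<N}. (cmod (fourier M (1 - real_of_int (lam A))))\<^sup>2)"
    unfolding S_def sum.reindex[OF inj] o_def using N by (intro sum_mono2) auto
  moreover have "\<dots> \<le> (1 - (1 / 2) ^ N) / 2"
    by (rule sum_norm_fourier_lam_le[OF M])
  moreover have "\<dots> \<le> 1 / 2" by simp
  ultimately show False by linarith
qed

theorem proposition4p9:
  shows "(\<exists>L. spectral_labeling L \<and> labeling_set L = Lam) \<and>
         maximal_orthogonal_exponentials mu4 (real_of_int ` Lam) \<and>
         \<not> is_spectrum mu4 (real_of_int ` Lam)"
proof -
  have "maximal_orthogonal_exponentials mu4 (real_of_int ` Lam)"
    using spectral_labeling_maximal[OF is_mu4_mu4 spectral_labeling_lam]
    by (simp add: labeling_set_lam)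
  moreover from this have "\<not> is_spectrum mu4 (real_of_int ` Lam)"
    using not_spectrum_Lam[OF is_mu4_mu4] by (simp add: maximal_orthogonal_exponentials_def)
  ultimately show ?thesis
    using spectral_labeling_lam labeling_set_lam by blast
qed

end
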